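(* Let $L$ be a nilpotent symplectic alternating algebra of dimension $2n\geq 10$ that is of maximal class. Then $L$ has a chain of characteristic ideals $$\{0\}=I_{0}<I_{1}<\cdots<I_{n}<I_{n-1}^{\perp}<\cdots<I_{1}^{\perp}<I_{0}^{\perp}=L$$ where for $0\leq k\leq n$, $I_{k}$ is isotropic of dimension $k$.
   Context: A symplectic alternating algebra over a field $F$ is a triple $(L,(\ ,\ ),\cdot)$ where $L$ is a finite-dimensional vector space over $F$ with a non-degenerate alternating bilinear form $(\ ,\ )$ and $\cdot$ is a bilinear alternating operation on $L$ (so $u\cdot u=0$ for all $u$) such that $(u\cdot v,w)=(v\cdot w,u)$ for all $u,v,w\in L$. Then $\dim L$ is even. For subspaces $U,V$, $UV$ is the subspace spanned by all products $u\cdot v$ with $u\in U,v\in V$. An ideal is a subspace $I$ with $IL\leq I$; $I^{\perp}$ is the orthogonal complement with respect to the form. A subspace is isotropic if the form vanishes on it. $L$ is nilpotent if there is a chain of ideals $\{0\}=J_{0}\leq\cdots\leq J_{m}=L$ with $J_{s}L\leq J_{s-1}$ for $s=1,\ldots,m$; the smallest possible $m$ is the nilpotence class. A nilpotent symplectic alternating algebra of dimension $2n\geq 8$ has class at most $2n-3$; it is of maximal class if its class equals $2n-3$. An automorphism of $L$ is a linear bijection $L\to L$ preserving both the form and the product; an ideal is characteristic if it is mapped to itself by every automorphism of $L$. *)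

theory Defs
  imports Main "HOL.Vector_Spaces"
begin

text \<open>The algebra lives on a whole type \<open>'v\<close>, with scalar multiplication \<open>scale\<close> over an
  arbitrary field \<open>'a\<close>. The form and the product are curried, and bilinearity is
  linearity in each argument.\<close>

locale symplectic_alternating_algebra = vector_space scale
  for scale :: "'a::field \<Rightarrow> 'v::ab_group_add \<Rightarrow> 'v" +
  fixes form :: "'v \<Rightarrow> 'v \<Rightarrow> 'a"
    and mult :: "'v \<Rightarrow> 'v \<Rightarrow> 'v"
  assumes finite_dim: "\<exists>B. finite B \<and> span B = UNIV"
    and form_linear_left: "Vector_Spaces.linear scale (*) (\<lambda>u. form u v)"
    and form_linear_right: "Vector_Spaces.linear scale (*) (form u)"
    and form_alternating: "form u u = 0"
    and form_nondegenerate: "(\<forall>v. form u v = 0) \<Longrightarrow> u = 0"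
    and mult_linear_left: "Vector_Spaces.linear scale scale (\<lambda>u. mult u v)"
    and mult_linear_right: "Vector_Spaces.linear scale scale (mult u)"
    and mult_alternating: "mult u u = 0"
    and form_mult_cyclic: "form (mult u v) w = form (mult v w) u"

text \<open>The following notions take the structure maps as explicit arguments.\<close>

definition saa_prod ::
  "('a::field \<Rightarrow> 'v::ab_group_add \<Rightarrow> 'v) \<Rightarrow> ('v \<Rightarrow> 'v \<Rightarrow> 'v) \<Rightarrow> 'v set \<Rightarrow> 'v set \<Rightarrow> 'v set" where
  "saa_prod scale mult U V = module.span scale {mult u v | u v. u \<in> U \<and> v \<in> V}"

definition saa_ideal ::
  "('a::field \<Rightarrow> 'v::ab_group_add \<Rightarrow> 'v) \<Rightarrow> ('v \<Rightarrow> 'v \<Rightarrow> 'v) \<Rightarrow> 'v set \<Rightarrow> bool" where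
  "saa_ideal scale mult I \<longleftrightarrow>
     module.subspace scale I \<and> saa_prod scale mult I UNIV \<subseteq> I"

definition saa_perp :: "('v \<Rightarrow> 'v \<Rightarrow> 'a::field) \<Rightarrow> 'v set \<Rightarrow> 'v set" where
  "saa_perp form U = {v. \<forall>u\<in>U. form u v = 0}"

definition saa_isotropic :: "('v \<Rightarrow> 'v \<Rightarrow> 'a::field) \<Rightarrow> 'v set \<Rightarrow> bool" where
  "saa_isotropic form U \<longleftrightarrow> (\<forall>u\<in>U. \<forall>v\<in>U. form u v = 0)"

definition saa_nilpotent_chain ::
  "('a::field \<Rightarrow> 'v::ab_group_add \<Rightarrow> 'v) \<Rightarrow> ('v \<Rightarrow> 'v \<Rightarrow> 'v) \<Rightarrow> nat \<Rightarrow> (nat \<Rightarrow> 'v set) \<Rightarrow> bool" where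
  "saa_nilpotent_chain scale mult m J \<longleftrightarrow>
     J 0 = {0} \<and> J m = UNIV \<and>
     (\<forall>s\<le>m. saa_ideal scale mult (J s)) \<and>
     (\<forall>s\<in>{1..m}. J (s - 1) \<subseteq> J s \<and> saa_prod scale mult (J s) UNIV \<subseteq> J (s - 1))"

definition saa_nilpotent ::
  "('a::field \<Rightarrow> 'v::ab_group_add \<Rightarrow> 'v) \<Rightarrow> ('v \<Rightarrow> 'v \<Rightarrow> 'v) \<Rightarrow> bool" where
  "saa_nilpotent scale mult \<longleftrightarrow> (\<exists>m J. saa_nilpotent_chain scale mult m J)"

text \<open>Only meaningful under \<^const>\<open>saa_nilpotent\<close>.\<close>

definition saa_class ::
  "('a::field \<Rightarrow> 'v::ab_group_add \<Rightarrow> 'v) \<Rightarrow> ('v \<Rightarrow> 'v \<Rightarrow> 'v) \<Rightarrow> nat" where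
  "saa_class scale mult = (LEAST m. \<exists>J. saa_nilpotent_chain scale mult m J)"

text \<open>Maximal class is a notion for nilpotent algebras of dimension \<open>2n \<ge> 8\<close>, where
  \<open>2n - 3\<close> is the general upper bound for the class.\<close>

definition saa_maximal_class ::
  "('a::field \<Rightarrow> 'v::ab_group_add \<Rightarrow> 'v) \<Rightarrow> ('v \<Rightarrow> 'v \<Rightarrow> 'v) \<Rightarrow> bool" where
  "saa_maximal_class scale mult \<longleftrightarrow>
     saa_nilpotent scale mult \<and>
     (\<exists>n. vector_space.dim scale (UNIV :: 'v set) = 2 * n \<and> 2 * n \<ge> 8 \<and>
          saa_class scale mult = 2 * n - 3)"

definition saa_automorphism ::
  "('a::field \<Rightarrow> 'v::ab_group_add \<Rightarrow> 'v) \<Rightarrow> ('v \<Rightarrow> 'v \<Rightarrow> 'a) \<Rightarrow> ('v \<Rightarrow> 'v \<Rightarrow> 'v) \<Rightarrow>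
   ('v \<Rightarrow> 'v) \<Rightarrow> bool" where
  "saa_automorphism scale form mult f \<longleftrightarrow>
     Vector_Spaces.linear scale scale f \<and> bij f \<and>
     (\<forall>u v. form (f u) (f v) = form u v) \<and>
     (\<forall>u v. f (mult u v) = mult (f u) (f v))"

definition saa_characteristic_ideal ::
  "('a::field \<Rightarrow> 'v::ab_group_add \<Rightarrow> 'v) \<Rightarrow> ('v \<Rightarrow> 'v \<Rightarrow> 'a) \<Rightarrow> ('v \<Rightarrow> 'v \<Rightarrow> 'v) \<Rightarrow>
   'v set \<Rightarrow> bool" where
  "saa_characteristic_ideal scale form mult I \<longleftrightarrow>
     saa_ideal scale mult I \<and>
     (\<forall>f. saa_automorphism scale form mult f \<longrightarrow> f ` I = I)"

end

theory Submission
  imports Defs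
begin

text \<open>Write \<open>lcs k\<close> for the \<open>(k + 1)\<close>-st term of the lower central series. Since
  \<open>(u v, w) = (u, w v)\<close>, the terms \<open>lcs i\<close> and \<open>lcs j\<close> are orthogonal iff \<open>lcs (i + j) = 0\<close>. As
  no operator \<open>x \<mapsto> v x\<close> has rank one, the series loses at least two dimensions at its first and
  at its last step. It also does so from \<open>lcs (n - 2)\<close> to \<open>lcs (n - 1)\<close>, because the former is not
  isotropic although it is orthogonal to the latter. In class \<open>2 n - 3\<close> these three losses account
  for the whole dimension, so every other step loses exactly one, and the series itself provides
  the ideals \<open>I\<^sub>k\<close> with \<open>2 \<le> k < n\<close>. There remain \<open>I\<^sub>1 = I\<^sub>4 I\<^sub>2\<^sup>\<bottom>\<close>, where
  \<open>n \<ge> 5\<close> is needed, and \<open>I\<^sub>n = I\<^bsub>n-1\<^esub> + I\<^bsub>n-2\<^esub>\<^sup>\<bottom> I\<^sub>k\<^sup>\<bottom>\<close> for a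
  suitable \<open>k\<close>.\<close>

text \<open>Reduces a claim about all of \<open>V\<close> to a single vector modulo
  \<open>W\<close>. If \<open>V = W\<close>, the vector is \<open>0\<close>, so that the caller need
  not distinguish cases.\<close>

lemma (in finite_dimensional_vector_space) codim_le_1E:
  assumes "subspace W" "subspace V" "W \<subseteq> V" "dim V \<le> dim W + 1"
  obtains v where "v \<in> V" "\<And>x. x \<in> V \<Longrightarrow> \<exists>k. x - scale k v \<in> W"
proof (cases "V \<subseteq> W")
  case True
  then show ?thesis
    using that[of 0] subspace_0[OF assms(2)] by (auto intro: exI[of _ 0])
next
  case False
  then obtain v where v: "v \<in> V" "v \<notin> W" by blast
  have "span (insert v W) \<subseteq> V"
    using v assms by (intro span_minimal) auto
  moreover have "dim (span (insert v W)) = dim W + 1"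
    using v assms(1) by (simp add: dim_insert span_eq_iff[THEN iffD2])
  ultimately have "span (insert v W) = V"
    using assms by (intro subspace_dim_equal) auto
  then show ?thesis
    using that[of v] v assms(1) by (auto simp: span_breakdown_eq span_eq_iff[THEN iffD2])
qed

section \<open>Finite dimension; identities for the form and the product\<close>

context symplectic_alternating_algebra
begin

text \<open>The dimension theory is stated relative to a fixed finite basis, whereas the axioms only
  give a finite spanning set; hence a choice.\<close>

definition some_basis :: "'v set" where
  "some_basis = (SOME B. finite B \<and> independent B \<and> span B = UNIV)"

lemma some_basis: "finite some_basis" "independent some_basis" "span some_basis = UNIV"
proof -
  obtain S where S: "finite S" "span S = UNIV" using finite_dim by blast
  obtain B where "B \<subseteq> S" "independent B" "S \<subseteq> span B"
    using maximal_independent_subset[of S] by blast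
  then have "\<exists>B. finite B \<and> independent B \<and> span B = UNIV"
    by (metis S finite_subset span_mono span_span top.extremum_uniqueI)
  from someI_ex[OF this] show "finite some_basis" "independent some_basis" "span some_basis = UNIV"
    unfolding some_basis_def by auto
qed

sublocale finite_dimensional_vector_space scale some_basis
  by unfold_locales (use some_basis in auto)

declare dim_UNIV [simp del]

lemma form_add_left: "form (u + v) w = form u w + form v w"
  and form_scale_left: "form (scale c u) w = c * form u w"
  and form_add_right: "form w (u + v) = form w u + form w v"
  and form_scale_right: "form w (scale c u) = c * form w u"
  and mult_add_left: "mult (u + v) w = mult u w + mult v w"
  and mult_scale_left: "mult (scale c u) w = scale c (mult u w)"
  and mult_add_right: "mult w (u + v) = mult w u + mult w v"
  and mult_scale_right: "mult w (scale c u) = scale c (mult w u)"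
  using form_linear_left[of w] form_linear_right[of w] mult_linear_left[of w] mult_linear_right[of w]
  unfolding Vector_Spaces.linear_iff by auto

lemma form_zero_left [simp]: "form 0 w = 0"
  and form_zero_right [simp]: "form w 0 = 0"
  and mult_zero_left [simp]: "mult 0 w = 0"
  and mult_zero_right [simp]: "mult w 0 = 0"
  using form_scale_left[of 0 0] form_scale_right[of _ 0 0] mult_scale_left[of 0 0]
    mult_scale_right[of _ 0 0] by auto

lemma form_skew: "form u v = - form v u"
proof -
  have "form u v + form v u = form (u + v) (u + v)"
    unfolding form_add_left form_add_right by (simp add: form_alternating add.commute)
  then show ?thesis by (simp add: form_alternating eq_neg_iff_add_eq_0)
qed

lemma form_zero_sym: "form u v = 0 \<longleftrightarrow> form v u = 0"
  using form_skew[of u v] by simp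

lemma mult_skew: "mult u v = - mult v u"
proof -
  have "mult u v + mult v u = mult (u + v) (u + v)"
    unfolding mult_add_left mult_add_right by (simp add: mult_alternating add.commute)
  then show ?thesis by (simp add: mult_alternating eq_neg_iff_add_eq_0)
qed

lemma form_neg_right: "form w (- u) = - form w u"
  using form_scale_right[of w "-1" u] by simp

text \<open>Multiplication by \<open>v\<close> is self-adjoint: after the cyclic shift, the sign
  from exchanging the arguments of the form cancels that from exchanging the factors.\<close>

lemma form_mult_adjoint: "form (mult u v) w = form u (mult w v)"
proof -
  have "form (mult u v) w = - form u (mult v w)"
    using form_mult_cyclic form_skew by metis
  also have "\<dots> = form u (mult w v)"
    by (subst mult_skew[of v w]) (simp add: form_neg_right)
  finally show ?thesis .
qed

lemma form_mult_self: "form (mult u v) v = 0"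
  by (simp add: form_mult_adjoint mult_alternating)

lemma eq_0I: "(\<And>v. form u v = 0) \<Longrightarrow> u = 0"
  using form_nondegenerate by blast

section \<open>Orthogonality and orthogonal complements\<close>

definition orth :: "'v set \<Rightarrow> 'v set \<Rightarrow> bool" where
  "orth U V \<longleftrightarrow> (\<forall>u\<in>U. \<forall>v\<in>V. form u v = 0)"

abbreviation perp where "perp \<equiv> saa_perp form"
abbreviation prd where "prd \<equiv> saa_prod scale mult"

lemma orthD: "orth U V \<Longrightarrow> u \<in> U \<Longrightarrow> v \<in> V \<Longrightarrow> form u v = 0"
  by (auto simp: orth_def)

lemma orth_sym: "orth U V \<longleftrightarrow> orth V U"
  unfolding orth_def using form_zero_sym by blast

lemma orth_iff_perp: "orth U V \<longleftrightarrow> V \<subseteq> perp U"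
  by (auto simp: orth_def saa_perp_def)

lemma subspace_perp: "subspace (perp U)"
  by (auto simp: saa_perp_def form_add_right form_scale_right intro!: subspaceI)

lemma perp_antimono: "U \<subseteq> V \<Longrightarrow> perp V \<subseteq> perp U"
  by (auto simp: saa_perp_def)

lemma perp_UNIV: "perp UNIV = {0}"
  using form_nondegenerate form_zero_sym by (auto simp: saa_perp_def)

lemma orth_span_left: "orth (span U) V \<longleftrightarrow> orth U V"
proof
  show "orth (span U) V \<Longrightarrow> orth U V"
    using span_superset by (auto simp: orth_def)
  assume "orth U V"
  then have "span U \<subseteq> perp V"
    by (intro span_minimal subspace_perp) (simp add: orth_iff_perp[symmetric] orth_sym)
  then show "orth (span U) V"
    by (simp add: orth_iff_perp[symmetric] orth_sym)
qed

lemma perp_span: "perp (span U) = perp U"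
  using orth_span_left[of U "{_}"] by (auto simp: orth_def saa_perp_def)

text \<open>On \<open>perp S\<close>, the second space is the kernel of the linear functional
  \<open>form a\<close>. If the functional takes a nonzero value at \<open>v\<close>, then
  \<open>v\<close> spans the rest.\<close>

lemma dim_perp_insert: "dim (perp S) \<le> dim (perp (insert a S)) + 1"
proof (cases "\<exists>v\<in>perp S. form a v \<noteq> 0")
  case False
  then have "perp S = perp (insert a S)" by (auto simp: saa_perp_def)
  then show ?thesis by simp
next
  case True
  then obtain v where v: "v \<in> perp S" "form a v \<noteq> 0" by blast
  have "x \<in> span (insert v (perp (insert a S)))" if "x \<in> perp S" for x
  proof -
    define y where "y = x + scale (- (form a x / form a v)) v"
    have "y \<in> perp S"
      unfolding y_def by (intro subspace_add subspace_scale subspace_perp that v)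
    moreover have "form a y = 0"
      using v by (simp only: y_def form_add_right form_scale_right) simp
    ultimately have "y \<in> perp (insert a S)" by (auto simp: saa_perp_def)
    then show ?thesis
      unfolding span_breakdown_eq by (intro exI[of _ "form a x / form a v"] span_base)
        (simp add: y_def scale_minus_left)
  qed
  then have "dim (perp S) \<le> dim (insert v (perp (insert a S)))"
    by (intro dim_mono) auto
  then show ?thesis by (simp add: dim_insert split: if_splits)
qed

lemma dim_perp_Un: "finite C \<Longrightarrow> dim (perp S) \<le> dim (perp (S \<union> C)) + card C"
proof (induction C rule: finite_induct)
  case (insert a C)
  then show ?case using dim_perp_insert[of "S \<union> C" a] by simp
qed simp

text \<open>Two counts with one constraint per basis vector: a basis of \<open>U\<close> cuts
  \<open>L\<close> down to \<open>perp U\<close>, and extending it to a basis of \<open>L\<close>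
  cuts \<open>perp U\<close> down to \<open>0\<close> by nondegeneracy.\<close>

lemma dim_perp:
  assumes "subspace U"
  shows "dim U + dim (perp U) = dim (UNIV :: 'v set)"
proof -
  obtain B where B: "B \<subseteq> U" "independent B" "U \<subseteq> span B" "card B = dim U"
    using basis_exists by blast
  have U: "U = span B" using B assms by (metis span_subspace)
  have E: "B \<subseteq> extend_basis B" "finite (extend_basis B)" "card (extend_basis B) = dim (UNIV :: 'v set)"
    using B(2) extend_basis_superset independent_extend_basis finiteI_independent
      span_extend_basis dim_span_eq_card_independent by metis+
  have "perp (B \<union> (extend_basis B - B)) = {0}"
    using E(1) perp_span[of "extend_basis B"] span_extend_basis[OF B(2)] perp_UNIV
    by (simp add: Un_absorb1)
  then have "dim (perp U) \<le> card (extend_basis B - B)"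
    using dim_perp_Un[of "extend_basis B - B" B] E by (simp add: U perp_span)
  moreover have "card (extend_basis B - B) + card B = dim (UNIV :: 'v set)"
    using E by (metis card_Diff_subset finite_subset le_add_diff_inverse2 card_mono)
  moreover have "dim (UNIV :: 'v set) \<le> dim (perp U) + card B"
    using dim_perp_Un[of B "{}"] B(2) finiteI_independent by (simp add: U perp_span) (simp add: saa_perp_def)
  ultimately show ?thesis using B(4) by linarith
qed

section \<open>Products of subspaces\<close>

lemma subspace_prd: "subspace (prd U V)"
  by (simp add: saa_prod_def)

lemma mult_in_prd: "u \<in> U \<Longrightarrow> v \<in> V \<Longrightarrow> mult u v \<in> prd U V"
  unfolding saa_prod_def by (rule span_base) blast

lemma prd_least: "subspace W \<Longrightarrow> (\<And>u v. u \<in> U \<Longrightarrow> v \<in> V \<Longrightarrow> mult u v \<in> W) \<Longrightarrow> prd U V \<subseteq> W"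
  unfolding saa_prod_def by (rule span_minimal) auto

lemma prd_mono: "U \<subseteq> U' \<Longrightarrow> V \<subseteq> V' \<Longrightarrow> prd U V \<subseteq> prd U' V'"
  by (intro prd_least subspace_prd mult_in_prd) auto

lemma orth_prd_iff: "orth (prd U V) W \<longleftrightarrow> (\<forall>u\<in>U. \<forall>v\<in>V. \<forall>w\<in>W. form (mult u v) w = 0)"
  unfolding saa_prod_def orth_span_left by (auto simp: orth_def)

text \<open>Self-adjointness on generators: the factor \<open>V\<close> moves across the
  form.\<close>

lemma orth_prd_swap: "orth (prd U V) W \<longleftrightarrow> orth U (prd W V)"
proof -
  have "orth U (prd W V) \<longleftrightarrow> (\<forall>u\<in>U. \<forall>v\<in>V. \<forall>w\<in>W. form u (mult w v) = 0)"
    unfolding orth_sym[of U] orth_prd_iff using form_zero_sym by blast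
  then show ?thesis by (simp add: orth_prd_iff form_mult_adjoint)
qed

text \<open>The form \<open>(v x, y)\<close> in \<open>x, y\<close> is alternating, so it does not have rank one.\<close>

lemma mult_eq_0_if_range_in_line:
  assumes "\<And>x. mult v x \<in> span {a}"
  shows "mult v x = 0"
proof (rule ccontr)
  assume ne: "mult v x \<noteq> 0"
  have "\<forall>x. \<exists>k. mult v x = scale k a"
    using assms by (auto simp: span_singleton)
  then obtain k where k: "\<And>x. mult v x = scale (k x) a" by metis
  then have kx: "k x \<noteq> 0" using ne by (metis scale_zero_left)
  have 1: "k y * form a y = 0" for y
    using form_mult_self[of v y] by (simp only: k form_scale_left)
  then have ax: "form a x = 0" using kx by (metis mult_eq_0_iff)
  have "form a y = 0" for y
  proof -
    \<comment> \<open>Exchanging \<open>x\<close> and \<open>y\<close> trades the unknown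
      \<open>form a y\<close> for \<open>form a x\<close>, which is already known to vanish.\<close>
    have "form (mult v x) y = - form (mult v y) x"
      unfolding form_mult_adjoint by (subst mult_skew) (rule form_neg_right)
    then have "k x * form a y = 0" by (simp only: k form_scale_left ax) simp
    then show ?thesis using kx by simp
  qed
  then have "a = 0" by (rule eq_0I)
  then show False using ne k by simp
qed

section \<open>The lower central series and nilpotent chains\<close>

primrec lcs :: "nat \<Rightarrow> 'v set" where
  "lcs 0 = UNIV"
| "lcs (Suc k) = prd (lcs k) UNIV"

lemma subspace_lcs: "subspace (lcs k)"
  by (cases k) (auto simp: subspace_prd)

lemma lcs_Suc_subset: "lcs (Suc k) \<subseteq> lcs k"
proof (induction k)
  case (Suc k)
  then show ?case using prd_mono[OF Suc subset_refl] by simp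
qed simp

lemma lcs_antimono: "i \<le> j \<Longrightarrow> lcs j \<subseteq> lcs i"
  using lcs_Suc_subset by (rule lift_Suc_antimono_le)

lemma mult_in_lcs: "u \<in> lcs k \<Longrightarrow> mult u v \<in> lcs (Suc k)"
  by (simp add: mult_in_prd)

lemma mult_in_lcs': "u \<in> lcs k \<Longrightarrow> mult v u \<in> lcs (Suc k)"
  using mult_in_lcs[of u k v] mult_skew[of v u] subspace_neg[OF subspace_lcs] by metis

lemma orth_UNIV_iff: "subspace U \<Longrightarrow> orth U UNIV \<longleftrightarrow> U = {0}"
  using orth_sym[of U UNIV] by (auto simp: orth_iff_perp perp_UNIV dest: subspace_0)

text \<open>The \<open>j\<close> factors on the right move to the left one by one, until
  nondegeneracy applies against all of \<open>L\<close>.\<close>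

lemma orth_lcs_iff: "orth (lcs i) (lcs j) \<longleftrightarrow> lcs (i + j) = {0}"
proof (induction j arbitrary: i)
  case 0
  then show ?case by (simp add: orth_UNIV_iff subspace_lcs)
next
  case (Suc j)
  then show ?case using orth_prd_swap[of "lcs i" UNIV "lcs j"] Suc[of "Suc i"] by simp
qed

lemma nilpotent_chain_lcs_subset:
  assumes "saa_nilpotent_chain scale mult m J" "s \<le> m"
  shows "lcs s \<subseteq> J (m - s)"
  using assms(2)
proof (induction s)
  case 0
  then show ?case using assms(1) by (simp add: saa_nilpotent_chain_def)
next
  case (Suc s)
  then have "lcs (Suc s) \<subseteq> prd (J (m - s)) UNIV"
    using prd_mono by simp
  also have "\<dots> \<subseteq> J (m - s - 1)"
    using assms(1) Suc.prems unfolding saa_nilpotent_chain_def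
    by (metis Suc_diff_le Suc_le_eq atLeastAtMost_iff diff_Suc_Suc diff_le_self le_add1 plus_1_eq_Suc)
  finally show ?case by simp
qed

text \<open>\<open>A L\<close> lies in \<open>lcs k L = lcs (Suc k)\<close>, hence in
  \<open>A\<close>. This covers the ideals that are not themselves terms of the series.\<close>

lemma saa_ideal_between:
  assumes "subspace A" "lcs (Suc k) \<subseteq> A" "A \<subseteq> lcs k"
  shows "saa_ideal scale mult A"
  using assms prd_mono[OF assms(3) subset_refl] by (auto simp: saa_ideal_def)

lemma lcs_ideal: "saa_ideal scale mult (lcs k)"
  by (rule saa_ideal_between[OF subspace_lcs lcs_Suc_subset subset_refl])

text \<open>The lower central series descends at least as fast as any chain read from the top, and
  reversed it is a chain itself. So the class is the first index at which it vanishes.\<close>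

lemma ex_nilpotent_chain_iff: "(\<exists>J. saa_nilpotent_chain scale mult m J) \<longleftrightarrow> lcs m = {0}"
proof
  assume "\<exists>J. saa_nilpotent_chain scale mult m J"
  then obtain J where J: "saa_nilpotent_chain scale mult m J" by blast
  then show "lcs m = {0}"
    using nilpotent_chain_lcs_subset[OF J, of m] subspace_0[OF subspace_lcs, of m]
    by (auto simp: saa_nilpotent_chain_def)
next
  assume 0: "lcs m = {0}"
  have "lcs (m - (s - 1)) = prd (lcs (m - s)) UNIV" if "s \<in> {1..m}" for s
  proof -
    have "m - (s - 1) = Suc (m - s)" using that by auto
    then show ?thesis by simp
  qed
  moreover have "lcs (m - (s - 1)) \<subseteq> lcs (m - s)" if "s \<in> {1..m}" for s
    by (rule lcs_antimono) simp
  ultimately have "saa_nilpotent_chain scale mult m (\<lambda>s. lcs (m - s))"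
    unfolding saa_nilpotent_chain_def using 0 lcs_ideal lcs_antimono by auto
  then show "\<exists>J. saa_nilpotent_chain scale mult m J" by blast
qed

text \<open>One repetition makes the series constant from there on, so it could not reach
  \<open>0\<close>.\<close>

lemma lcs_psubset:
  assumes "lcs c = {0}" "lcs k \<noteq> {0}"
  shows "lcs (Suc k) \<subset> lcs k"
proof (rule ccontr)
  assume "\<not> ?thesis"
  then have eq: "prd (lcs k) UNIV = lcs k" using lcs_Suc_subset[of k] by auto
  have "lcs (k + j) = lcs k" for j
    by (induction j) (simp_all add: eq)
  then show False
    using lcs_antimono[of c "k + c"] assms subspace_0[OF subspace_lcs, of k] by auto
qed

lemma dim_lcs_less:
  assumes "lcs c = {0}" "lcs k \<noteq> {0}"
  shows "dim (lcs (Suc k)) < dim (lcs k)"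
  using lcs_psubset[OF assms] by (metis dim_psubset span_eq_iff subspace_lcs)

section \<open>Invariance under automorphisms\<close>

text \<open>Kept apart from the ideal property because invariance alone passes through products,
  spans and complements.\<close>

definition invariant :: "'v set \<Rightarrow> bool" where
  "invariant A \<longleftrightarrow> (\<forall>f. saa_automorphism scale form mult f \<longrightarrow> f ` A = A)"

lemma image_span:
  assumes "saa_automorphism scale form mult f"
  shows "f ` span A = span (f ` A)"
proof -
  interpret f: Vector_Spaces.linear scale scale f
    using assms by (simp add: saa_automorphism_def)
  show ?thesis by (rule f.span_image[symmetric])
qed

lemma invariant_UNIV: "invariant UNIV"
  by (auto simp: invariant_def saa_automorphism_def bij_def)

lemma invariant_span_Un: "invariant A \<Longrightarrow> invariant B \<Longrightarrow> invariant (span (A \<union> B))"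
  by (auto simp: invariant_def image_span image_Un)

lemma invariant_prd:
  assumes "invariant U" "invariant V"
  shows "invariant (prd U V)"
  unfolding invariant_def
proof (intro allI impI)
  fix f assume f: "saa_automorphism scale form mult f"
  have UV: "f ` U = U" "f ` V = V" using assms f by (auto simp: invariant_def)
  have "f ` {mult u v | u v. u \<in> U \<and> v \<in> V} = {mult (f u) (f v) | u v. u \<in> U \<and> v \<in> V}"
    using f unfolding saa_automorphism_def by (force simp: image_def)
  also have "\<dots> = {mult u v | u v. u \<in> f ` U \<and> v \<in> f ` V}" by blast
  finally show "f ` prd U V = prd U V"
    unfolding saa_prod_def image_span[OF f] UV by simp
qed

lemma invariant_perp:
  assumes "invariant U"
  shows "invariant (perp U)"
  unfolding invariant_def
proof (intro allI impI)
  fix f assume f: "saa_automorphism scale form mult f"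
  have U: "f ` U = U" using assms f by (auto simp: invariant_def)
  have iso: "form (f u) (f v) = form u v" for u v using f by (simp add: saa_automorphism_def)
  have "f ` perp U = perp (f ` U)"
  proof (rule set_eqI)
    fix y
    obtain x where x: "y = f x" using f unfolding saa_automorphism_def bij_def surj_def by blast
    have "inj f" using f by (simp add: saa_automorphism_def bij_def)
    then show "y \<in> f ` perp U \<longleftrightarrow> y \<in> perp (f ` U)"
      by (simp add: x inj_image_mem_iff saa_perp_def iso)
  qed
  then show "f ` perp U = perp U" by (simp add: U)
qed

lemma invariant_lcs: "invariant (lcs k)"
  by (induction k) (auto intro: invariant_UNIV invariant_prd)

text \<open>Since \<open>I L\<close> lies in \<open>I\<close>, it is orthogonal to
  \<open>perp I\<close>; moving \<open>L\<close> across makes \<open>(perp I) L\<close> orthogonal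
  to \<open>I\<close>.\<close>

lemma perp_ideal:
  assumes "saa_ideal scale mult I"
  shows "saa_ideal scale mult (perp I)"
proof -
  have "orth (prd I UNIV) (perp I)"
    using assms by (auto simp: orth_def saa_ideal_def saa_perp_def)
  then show ?thesis
    unfolding saa_ideal_def orth_prd_swap orth_iff_perp[symmetric]
    using subspace_perp orth_sym by blast
qed

section \<open>Reduction modulo subspaces of codimension one\<close>

text \<open>For \<open>u\<close> and \<open>v\<close> known modulo smaller subspaces up to multiples
  of \<open>b\<close> and \<open>w\<close>: once the last two summands are negligible, all products
  lie on the line of \<open>mult b w\<close>.\<close>

lemma mult_expand:
  "mult u v = scale (k * l) (mult b w) + scale k (mult b (v - scale l w)) + mult (u - scale k b) v"
proof -
  have "mult u v = mult (scale k b + (u - scale k b)) v" by simp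
  also have "\<dots> = scale k (mult b v) + mult (u - scale k b) v"
    by (simp only: mult_add_left mult_scale_left)
  also have "mult b v = mult b (scale l w + (v - scale l w))" by simp
  also have "\<dots> = scale l (mult b w) + mult b (v - scale l w)"
    by (simp only: mult_add_right mult_scale_right)
  finally show ?thesis by (simp add: scale_right_distrib)
qed

lemma form_expand: "form x v = l * form x w + form x (v - scale l w)"
proof -
  have "form x v = form x (scale l w + (v - scale l w))" by simp
  then show ?thesis by (simp only: form_add_right form_scale_right)
qed

text \<open>\<open>V\<close> is spanned by \<open>W\<close> and one vector \<open>a\<close>; as
  \<open>W\<close> is orthogonal to \<open>V\<close>, only \<open>form a a = 0\<close>
  remains.\<close>

lemma orth_codim_1:
  assumes "subspace W" "subspace V" "W \<subseteq> V" "dim V \<le> dim W + 1" "orth W V"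
  shows "orth V V"
proof -
  obtain a where a: "a \<in> V" "\<And>x. x \<in> V \<Longrightarrow> \<exists>k. x - scale k a \<in> W"
    using codim_le_1E[OF assms(1-4)] by blast
  have aV: "form a y = 0" if y: "y \<in> V" for y
  proof -
    obtain k where "y - scale k a \<in> W" using a(2)[OF y] by blast
    then have "form a (y - scale k a) = 0"
      using assms(5) a(1) orthD form_zero_sym by blast
    then show ?thesis using form_expand[of a y k a] by (simp add: form_alternating)
  qed
  have "form y x = 0" if x: "x \<in> V" and y: "y \<in> V" for x y
  proof -
    obtain k where "x - scale k a \<in> W" using a(2)[OF x] by blast
    then have "form y (x - scale k a) = 0"
      using assms(5) y orthD form_zero_sym by blast
    moreover have "form y a = 0" using aV[OF y] form_zero_sym by blast
    ultimately show ?thesis using form_expand[of y x k a] by simp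
  qed
  then show ?thesis by (simp add: orth_def)
qed

lemma mult_eq_0_if_range_dim_le_1:
  assumes "subspace V" "dim V \<le> 1" "\<And>x. mult v x \<in> V"
  shows "mult v x = 0"
proof -
  have "{0} \<subseteq> V" "dim V \<le> dim {0} + 1" using assms(1,2) subspace_0 by auto
  then obtain a where "\<And>x. x \<in> V \<Longrightarrow> \<exists>k. x - scale k a \<in> {0}"
    using codim_le_1E[OF subspace_single_0 assms(1)] by metis

  then have "V \<subseteq> span {a}" by (auto simp: span_breakdown_eq)
  then show ?thesis using mult_eq_0_if_range_in_line assms(3) by blast
qed

text \<open>\<open>(u v, z) = (u, z v)\<close> with \<open>z v\<close> in
  \<open>lcs (Suc j)\<close>, which is orthogonal to \<open>lcs i\<close>.\<close>

lemma mult_lcs_eq_0: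
  assumes "lcs (Suc (i + j)) = {0}" "u \<in> lcs i" "v \<in> lcs j"
  shows "mult u v = 0"
proof (rule eq_0I)
  fix z
  have "orth (lcs i) (lcs (Suc j))" using assms(1) by (simp only: orth_lcs_iff add_Suc_right)
  then show "form (mult u v) z = 0"
    unfolding form_mult_adjoint using assms(2) mult_in_lcs'[OF assms(3)] by (rule orthD)
qed

end

section \<open>Dimensions of the lower central series in maximal class\<close>

locale maximal_class_saa = symplectic_alternating_algebra scale form mult
  for scale :: "'a::field \<Rightarrow> 'v::ab_group_add \<Rightarrow> 'v" and form mult +
  fixes n :: nat
  assumes n_ge_5: "5 \<le> n"
    and dim_eq: "dim (UNIV :: 'v set) = 2 * n"
    and lcs_eq_0: "lcs (2 * n - 3) = {0}"
    and lcs_ne_0: "lcs (2 * n - 4) \<noteq> {0}"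
begin

declare lcs.simps(2) [simp del]

lemma lcs_eq_0_iff: "lcs k = {0} \<longleftrightarrow> 2 * n - 3 \<le> k"
proof
  assume 0: "lcs k = {0}"
  show "2 * n - 3 \<le> k"
  proof (rule ccontr)
    assume "\<not> ?thesis"
    then have "lcs (2 * n - 4) \<subseteq> lcs k" by (intro lcs_antimono) simp
    then show False using 0 lcs_ne_0 subspace_0[OF subspace_lcs] by blast
  qed
next
  assume "2 * n - 3 \<le> k"
  then show "lcs k = {0}"
    using lcs_antimono[of "2 * n - 3" k] lcs_eq_0 subspace_0[OF subspace_lcs, of k] by auto
qed

lemma orth_lcs: "orth (lcs i) (lcs j) \<longleftrightarrow> 2 * n - 3 \<le> i + j"
  by (simp add: orth_lcs_iff lcs_eq_0_iff)

lemma dim_lcs_Suc: "k < 2 * n - 3 \<Longrightarrow> dim (lcs (Suc k)) < dim (lcs k)"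
  using dim_lcs_less[OF lcs_eq_0, of k] by (simp add: lcs_eq_0_iff)

text \<open>Otherwise each element of \<open>lcs (2 * n - 5)\<close> would multiply \<open>L\<close>
  into a line, hence to \<open>0\<close>, and the last nonzero term would vanish.\<close>

lemma dim_lcs_last: "2 \<le> dim (lcs (2 * n - 4))"
proof (rule ccontr)
  assume *: "\<not> ?thesis"
  have "mult v x = 0" if "v \<in> lcs (2 * n - 5)" for v x
  proof (rule mult_eq_0_if_range_dim_le_1[OF subspace_lcs])
    show "dim (lcs (2 * n - 4)) \<le> 1" using * by simp
    have "Suc (2 * n - 5) = 2 * n - 4" using n_ge_5 by simp
    then show "mult v x \<in> lcs (2 * n - 4)" for x using mult_in_lcs[OF that] by metis
  qed
  then have "lcs (Suc (2 * n - 5)) \<subseteq> {0}" unfolding lcs.simps by (intro prd_least) auto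
  then have "lcs (Suc (2 * n - 5)) = {0}" using subspace_0[OF subspace_lcs] by blast
  then show False using lcs_eq_0_iff[of "Suc (2 * n - 5)"] n_ge_5 by simp
qed

text \<open>Dual to the bound on the last term: elements of \<open>perp (lcs 2)\<close> multiply
  \<open>L\<close> into \<open>perp (lcs 1)\<close>. Were this at most a line, they would annihilate
  \<open>L\<close> and so be orthogonal to \<open>lcs 1\<close>, although \<open>lcs 2\<close> is
  strictly smaller than \<open>lcs 1\<close>.\<close>

lemma dim_lcs_1: "dim (lcs 1) \<le> 2 * n - 2"
proof (rule ccontr)
  assume *: "\<not> ?thesis"
  have "mult v x = 0" if v: "v \<in> perp (lcs 2)" for v x
  proof (rule mult_eq_0_if_range_dim_le_1[OF subspace_perp])
    show "dim (perp (lcs 1)) \<le> 1" using * dim_perp[OF subspace_lcs, of 1] dim_eq by linarith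
    have "orth (lcs 2) {v}" using v unfolding orth_iff_perp by blast
    then have "orth {v} (prd (lcs 1) UNIV)"
      by (subst orth_sym) (simp add: numeral_2_eq_2 lcs.simps)
    then have "orth (lcs 1) (prd {v} UNIV)"
      using orth_prd_swap orth_sym by blast
    then show "mult v x \<in> perp (lcs 1)" for x
      using mult_in_prd unfolding orth_iff_perp by blast
  qed
  then have "orth (prd (perp (lcs 2)) UNIV) (lcs 0)"
    by (auto simp: orth_prd_iff)
  then have "orth (lcs 1) (perp (lcs 2))"
    using orth_sym by (simp add: orth_prd_swap lcs.simps)
  then have "dim (perp (lcs 2)) \<le> dim (perp (lcs 1))"
    by (intro dim_subset) (simp add: orth_iff_perp)
  then show False
    using dim_perp[OF subspace_lcs, of 1] dim_perp[OF subspace_lcs, of 2] dim_lcs_Suc[of 1] n_ge_5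
    unfolding Suc_1 by linarith
qed

text \<open>The indices \<open>n - 2\<close> and \<open>n - 1\<close> add up to
  \<open>2 * n - 3\<close>, but twice \<open>n - 2\<close> falls short by one. A loss of at most one
  would make \<open>lcs (n - 2)\<close> isotropic.\<close>

lemma dim_lcs_middle: "dim (lcs (n - 1)) + 2 \<le> dim (lcs (n - 2))"
proof (rule ccontr)
  assume "\<not> ?thesis"
  then have "orth (lcs (n - 2)) (lcs (n - 2))"
    using n_ge_5 by (intro orth_codim_1[of "lcs (n - 1)"])
      (auto simp: orth_lcs subspace_lcs intro!: lcs_antimono)
  then show False using n_ge_5 by (simp add: orth_lcs)
qed

text \<open>Losses are counted downwards from \<open>lcs 1\<close>, at least one per step; beyond
  the middle the extra loss improves the bound by one.\<close>

lemma dim_lcs_upper: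
  assumes "1 \<le> k" "k \<le> n - 2"
  shows "dim (lcs k) + k \<le> 2 * n - 1"
  using assms
proof (induction k rule: dec_induct)
  case base
  then show ?case using dim_lcs_1 n_ge_5 by simp
next
  case (step m)
  then have "m < 2 * n - 3" using n_ge_5 by simp
  then show ?case using dim_lcs_Suc[of m] step by linarith
qed

lemma dim_lcs_upper':
  assumes "n - 1 \<le> k" "k \<le> 2 * n - 4"
  shows "dim (lcs k) + k \<le> 2 * n - 2"
  using assms
proof (induction k rule: dec_induct)
  case base
  then show ?case using dim_lcs_middle dim_lcs_upper[of "n - 2"] n_ge_5 by linarith
next
  case (step m)
  then have "m < 2 * n - 3" using n_ge_5 by simp
  then show ?case using dim_lcs_Suc[of m] step by linarith
qed

text \<open>The same losses are counted upwards from the last nonzero term. Both counts meet, so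
  every inequality is an equality.\<close>

lemma dim_lcs_lower':
  assumes "k \<le> 2 * n - 4"
  shows "2 * n - 2 \<le> dim (lcs k) + k"
  using assms
proof (induction k rule: inc_induct)
  case base
  then show ?case using dim_lcs_last n_ge_5 by simp
next
  case (step m)
  then have "m < 2 * n - 3" using n_ge_5 by simp
  then show ?case using dim_lcs_Suc[of m] step by linarith
qed

lemma dim_lcs_lower:
  assumes "k \<le> n - 2"
  shows "2 * n - 1 \<le> dim (lcs k) + k"
  using assms
proof (induction k rule: inc_induct)
  case base
  then show ?case using dim_lcs_middle dim_lcs_lower'[of "n - 1"] n_ge_5 by linarith
next
  case (step m)
  then have "m < 2 * n - 3" using n_ge_5 by simp
  then show ?case using dim_lcs_Suc[of m] step by linarith
qed

lemma dim_lcs: "1 \<le> k \<Longrightarrow> k \<le> n - 2 \<Longrightarrow> dim (lcs k) = 2 * n - 1 - k"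
  using dim_lcs_upper[of k] dim_lcs_lower[of k] by simp

lemma dim_lcs': "n - 1 \<le> k \<Longrightarrow> k \<le> 2 * n - 4 \<Longrightarrow> dim (lcs k) = 2 * n - 2 - k"
  using dim_lcs_upper'[of k] dim_lcs_lower'[of k] by simp

lemma dim_lcs_half: "dim (lcs (n - 1)) = n - 1"
  using dim_lcs'[of "n - 1"] n_ge_5 by simp

text \<open>Orthogonality gives one inclusion, and the dimensions agree:
  \<open>lcs (2 * n - 3 - k)\<close> lies in the lower half of the series and has dimension
  \<open>k + 1\<close>.\<close>

lemma perp_lcs:
  assumes "1 \<le> k" "k \<le> n - 2"
  shows "perp (lcs (2 * n - 3 - k)) = lcs k"
proof (rule sym, rule subspace_dim_equal[OF subspace_lcs subspace_perp])
  show "lcs k \<subseteq> perp (lcs (2 * n - 3 - k))"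
    using assms n_ge_5 by (simp add: orth_iff_perp[symmetric] orth_lcs)
  show "dim (perp (lcs (2 * n - 3 - k))) \<le> dim (lcs k)"
    using dim_perp[OF subspace_lcs, of "2 * n - 3 - k"] dim_lcs[OF assms]
      dim_lcs'[of "2 * n - 3 - k"] assms n_ge_5 dim_eq by simp
qed

section \<open>The ideal of dimension one\<close>

text \<open>The factors are \<open>I\<^sub>4\<close> and the complement of \<open>I\<^sub>2\<close>,
  written as terms of the series.\<close>

definition centre_line :: "'v set" where
  "centre_line = prd (lcs (2 * n - 6)) (lcs 1)"

text \<open>Up to sign \<open>(u v, x)\<close> is \<open>(u x, v)\<close>, so vanishing would make
  \<open>lcs (2 * n - 5)\<close> orthogonal to \<open>lcs 1\<close>; these indices add up to only
  \<open>2 * n - 4\<close>.\<close>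

lemma centre_line_ne_0: "\<not> centre_line \<subseteq> {0}"
proof
  assume "centre_line \<subseteq> {0}"
  then have 0: "mult u v = 0" if "u \<in> lcs (2 * n - 6)" "v \<in> lcs 1" for u v
    using mult_in_prd[OF that] by (auto simp: centre_line_def)
  have "form (mult u x) v = 0" if "u \<in> lcs (2 * n - 6)" "v \<in> lcs 1" for u x v
  proof -
    have "form (mult u v) x = form u (mult x v)" by (rule form_mult_adjoint)
    then show ?thesis
      using 0[OF that] by (simp add: form_mult_adjoint mult_skew[of v x] form_neg_right)
  qed
  then have "orth (lcs (Suc (2 * n - 6))) (lcs 1)"
    unfolding lcs.simps(2)[of "2 * n - 6"] orth_prd_iff by blast
  then show False using n_ge_5 by (simp add: orth_lcs)
qed

lemma centre_line_props: "dim centre_line = 1" "centre_line \<subseteq> lcs (2 * n - 4)"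
proof -
  \<comment> \<open>A loss of one requires \<open>n - 1 \<le> 2 * n - 6\<close>, that is
    \<open>n \<ge> 5\<close>; for \<open>n = 4\<close> this would be the middle step, which loses
    two.\<close>
  have "lcs (2 * n - 5) \<subseteq> lcs (2 * n - 6)" "dim (lcs (2 * n - 6)) \<le> dim (lcs (2 * n - 5)) + 1"
    using dim_lcs'[of "2 * n - 6"] dim_lcs'[of "2 * n - 5"] n_ge_5 lcs_antimono[of "2 * n - 6" "2 * n - 5"]
    by auto
  then obtain b where b: "b \<in> lcs (2 * n - 6)"
      "\<And>x. x \<in> lcs (2 * n - 6) \<Longrightarrow> \<exists>k. x - scale k b \<in> lcs (2 * n - 5)"
    using codim_le_1E[OF subspace_lcs subspace_lcs] by metis
  have "lcs 2 \<subseteq> lcs 1" "dim (lcs 1) \<le> dim (lcs 2) + 1"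
    using dim_lcs[of 1] dim_lcs[of 2] lcs_antimono[of 1 2] n_ge_5 by auto
  then obtain w where w: "w \<in> lcs 1" "\<And>x. x \<in> lcs 1 \<Longrightarrow> \<exists>k. x - scale k w \<in> lcs 2"
    using codim_le_1E[OF subspace_lcs subspace_lcs] by metis
  have b2: "mult b v = 0" if "v \<in> lcs 2" for v
    using mult_lcs_eq_0[OF _ b(1) that] n_ge_5 by (simp add: lcs_eq_0_iff)
  \<comment> \<open>Replacing either factor by its remainder raises the sum of indices to
    \<open>2 * n - 4\<close>, where products vanish.\<close>
  have "mult u v \<in> span {mult b w}" if u: "u \<in> lcs (2 * n - 6)" and v: "v \<in> lcs 1" for u v
  proof -
    obtain k l where k: "u - scale k b \<in> lcs (2 * n - 5)" and l: "v - scale l w \<in> lcs 2"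
      using b(2)[OF u] w(2)[OF v] by blast
    have "mult (u - scale k b) v = 0"
      using mult_lcs_eq_0[OF _ k v] n_ge_5 by (simp add: lcs_eq_0_iff)
    then have "mult u v = scale (k * l) (mult b w)"
      using mult_expand[of u v k l b w] b2[OF l] by simp
    then show ?thesis by (simp add: span_base span_scale)
  qed
  then have sub: "centre_line \<subseteq> span {mult b w}"
    unfolding centre_line_def by (rule prd_least[OF subspace_span])
  have "dim centre_line \<le> dim {mult b w}" using sub by (rule dim_mono)
  also have "\<dots> \<le> 1" by simp
  finally show "dim centre_line = 1"
    using centre_line_ne_0 dim_eq_0[of centre_line] by linarith
  \<comment> \<open>On \<open>w\<close> the form vanishes by alternation; on \<open>lcs 2\<close> it
    becomes \<open>form b\<close> on \<open>lcs 3\<close>, with index sum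
    \<open>2 * n - 3\<close>.\<close>
  have "form v (mult b w) = 0" if v: "v \<in> lcs 1" for v
  proof -
    obtain l where l: "v - scale l w \<in> lcs 2" using w(2)[OF v] by blast
    have "form (mult b w) (v - scale l w) = 0"
      unfolding form_mult_adjoint
      by (rule orthD[OF _ b(1) mult_in_lcs[OF l]]) (use n_ge_5 in \<open>simp add: orth_lcs\<close>)
    then have "form (mult b w) v = 0"
      using form_expand[of "mult b w" v l w] by (simp add: form_mult_self)
    then show ?thesis using form_zero_sym by blast
  qed
  then have "mult b w \<in> perp (lcs 1)" by (simp add: saa_perp_def)
  moreover have "perp (lcs 1) = lcs (2 * n - 4)"
  proof (rule sym, rule subspace_dim_equal[OF subspace_lcs subspace_perp])
    show "lcs (2 * n - 4) \<subseteq> perp (lcs 1)"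
      using n_ge_5 by (simp add: orth_iff_perp[symmetric] orth_lcs)
    show "dim (perp (lcs 1)) \<le> dim (lcs (2 * n - 4))"
      using dim_perp[OF subspace_lcs, of 1] dim_lcs[of 1] dim_lcs'[of "2 * n - 4"] n_ge_5 dim_eq
      by simp
  qed
  ultimately show "centre_line \<subseteq> lcs (2 * n - 4)"
    using sub span_minimal[of "{mult b w}" "lcs (2 * n - 4)"] subspace_lcs by simp
qed

section \<open>The members of dimension less than \<open>n\<close>\<close>

text \<open>For \<open>2 \<le> k < n\<close> this picks the term of dimension \<open>k\<close>. The
  double loss at the end of the series skips dimension \<open>1\<close>, which
  \<open>centre_line\<close> supplies.\<close>

definition flag :: "nat \<Rightarrow> 'v set" where
  "flag k = (if k = 0 then {0} else if k = 1 then centre_line else lcs (2 * n - 2 - k))"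

lemma subspace_flag: "subspace (flag k)"
  by (simp add: flag_def subspace_lcs centre_line_def subspace_prd)

lemma dim_flag: "k < n \<Longrightarrow> dim (flag k) = k"
  by (cases "2 \<le> k") (auto simp: flag_def centre_line_props dim_lcs' not_le less_Suc_eq numeral_2_eq_2)

lemma flag_mono: "flag k \<subseteq> flag (Suc k)"
proof -
  consider "k = 0" | "k = 1" | "2 \<le> k" by linarith
  then show ?thesis
  proof cases
    case 1
    then show ?thesis using subspace_0[OF subspace_flag] by (simp add: flag_def[of 0])
  next
    case 2
    then show ?thesis using centre_line_props by (simp add: flag_def)
  next
    case 3
    then show ?thesis by (simp add: flag_def lcs_antimono)
  qed
qed

lemma flag_psubset: "Suc k < n \<Longrightarrow> flag k \<subset> flag (Suc k)"
  using flag_mono[of k] dim_flag[of k] dim_flag[of "Suc k"] by fastforce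

lemma perp_flag: "2 \<le> k \<Longrightarrow> k < n \<Longrightarrow> perp (flag k) = lcs (k - 1)"
  using perp_lcs[of "k - 1"] by (simp add: flag_def)

lemma dim_perp_flag: "k < n \<Longrightarrow> dim (perp (flag k)) = 2 * n - k"
  using dim_perp[OF subspace_flag, of k] dim_flag[of k] dim_eq by simp

lemma orth_flag:
  assumes "k < n"
  shows "orth (flag k) (flag k)"
proof (cases "2 \<le> k")
  case True
  then show ?thesis using assms by (simp add: flag_def orth_lcs)
next
  case False
  then have "flag k \<subseteq> flag 2"
    using flag_mono[of 0] flag_mono[of 1] by (auto simp: numeral_2_eq_2 less_Suc_eq not_le)
  moreover have "orth (flag 2) (flag 2)" using n_ge_5 by (simp add: flag_def orth_lcs)
  ultimately show ?thesis by (auto simp: orth_def)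
qed

lemma flag_ideal: "saa_ideal scale mult (flag k)"
proof -
  consider "k = 0" | "k = 1" | "2 \<le> k" by linarith
  then show ?thesis
  proof cases
    case 1
    then show ?thesis using lcs_ideal[of "2 * n - 3"] lcs_eq_0 by (simp add: flag_def)
  next
    case 2
    have "Suc (2 * n - 4) = 2 * n - 3" using n_ge_5 by simp
    then have "lcs (Suc (2 * n - 4)) \<subseteq> flag k"
      using lcs_eq_0 subspace_0[OF subspace_flag] by simp
    then show ?thesis
      using 2 centre_line_props(2) by (intro saa_ideal_between[OF subspace_flag]) (auto simp: flag_def)
  next
    case 3
    then show ?thesis by (simp add: flag_def lcs_ideal)
  qed
qed

lemma invariant_flag: "invariant (flag k)"
proof -
  have "invariant {0}" using invariant_lcs[of "2 * n - 3"] lcs_eq_0 by simp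
  then show ?thesis by (simp add: flag_def invariant_lcs centre_line_def invariant_prd)
qed

section \<open>The member of dimension \<open>n\<close>\<close>

text \<open>As \<open>k\<close> runs from \<open>0\<close> to \<open>n - 1\<close>, the candidates \<open>mid k\<close> descend from \<open>lcs (n - 2)\<close> to
  \<open>lcs (n - 1)\<close>, losing at most one dimension at each step. Hence one of them is half-way.\<close>

definition mid :: "nat \<Rightarrow> 'v set" where
  "mid k = span (lcs (n - 1) \<union> prd (lcs (n - 3)) (perp (flag k)))"

lemma ex_mid: "\<exists>k. lcs (n - 1) \<subseteq> mid k \<and> mid k \<subseteq> lcs (n - 2) \<and> dim (mid k) = n"
proof -
  have Suc_n: "Suc (n - 3) = n - 2" "Suc (n - 2) = n - 1" using n_ge_5 by auto
  have mid_prd: "prd (lcs (n - 3)) (perp (flag k)) \<subseteq> mid k" for k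
    unfolding mid_def using span_superset by blast
  have "mid (n - 1) \<subseteq> lcs (n - 1)"
    unfolding mid_def
  proof (intro span_minimal Un_least subset_refl subspace_lcs prd_least)
    fix u v assume "v \<in> perp (flag (n - 1))"
    then have "v \<in> lcs (n - 2)" using perp_flag[of "n - 1"] n_ge_5 by (simp add: numeral_2_eq_2)
    then show "mult u v \<in> lcs (n - 1)" using mult_in_lcs' Suc_n(2) by metis
  qed
  moreover have "\<not> mid 0 \<subseteq> lcs (n - 1)"
  proof
    assume "mid 0 \<subseteq> lcs (n - 1)"
    then have "prd (lcs (n - 3)) (perp (flag 0)) \<subseteq> lcs (n - 1)" using mid_prd by blast
    moreover have "perp (flag 0) = UNIV" by (simp add: saa_perp_def flag_def)
    ultimately have "lcs (Suc (n - 3)) \<subseteq> lcs (n - 1)" by (simp add: lcs.simps)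
    then have "dim (lcs (n - 2)) \<le> dim (lcs (n - 1))" unfolding Suc_n by (rule dim_subset)
    then show False using dim_lcs_middle by simp
  qed
  \<comment> \<open>\<open>k\<close> is the last index before the candidates first collapse into
    \<open>lcs (n - 1)\<close>.\<close>
  ultimately obtain k where k: "k < n - 1" "\<not> mid k \<subseteq> lcs (n - 1)" "mid (Suc k) \<subseteq> lcs (n - 1)"
    using ex_least_nat_less[of "\<lambda>k. mid k \<subseteq> lcs (n - 1)" "n - 1"] by blast
  have "dim (perp (flag k)) \<le> dim (perp (flag (Suc k))) + 1"
    using dim_perp_flag[of k] dim_perp_flag[of "Suc k"] k(1) by simp
  then obtain y where y: "y \<in> perp (flag k)"
      "\<And>x. x \<in> perp (flag k) \<Longrightarrow> \<exists>l. x - scale l y \<in> perp (flag (Suc k))"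
    using codim_le_1E[OF subspace_perp subspace_perp perp_antimono[OF flag_mono]] by metis
  have "lcs (n - 2) \<subseteq> lcs (n - 3)" "dim (lcs (n - 3)) \<le> dim (lcs (n - 2)) + 1"
    using dim_lcs[of "n - 3"] dim_lcs[of "n - 2"] n_ge_5 lcs_antimono[of "n - 3" "n - 2"] by auto
  then obtain z where z: "z \<in> lcs (n - 3)"
      "\<And>x. x \<in> lcs (n - 3) \<Longrightarrow> \<exists>l. x - scale l z \<in> lcs (n - 2)"
    using codim_le_1E[OF subspace_lcs subspace_lcs] by metis
  have base: "x \<in> span (insert a (lcs (n - 1)))" if "x \<in> lcs (n - 1)" for x a
    using that by (intro span_base) simp
  \<comment> \<open>A remainder of \<open>u\<close> multiplies into \<open>lcs (n - 1)\<close> by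
    the series, a remainder of \<open>v\<close> by the collapse of \<open>mid (Suc k)\<close>. So
    \<open>mid k\<close> is larger by at most one dimension.\<close>
  have "mult u v \<in> span (insert (mult z y) (lcs (n - 1)))"
    if u: "u \<in> lcs (n - 3)" and v: "v \<in> perp (flag k)" for u v
  proof -
    obtain a b where a: "u - scale a z \<in> lcs (n - 2)" and b: "v - scale b y \<in> perp (flag (Suc k))"
      using z(2)[OF u] y(2)[OF v] by blast
    have 1: "mult (u - scale a z) v \<in> lcs (n - 1)" using mult_in_lcs[OF a] Suc_n by metis
    have 2: "mult z (v - scale b y) \<in> lcs (n - 1)"
      using mult_in_prd[OF z(1) b] mid_prd k(3) by blast
    show ?thesis
      unfolding mult_expand[of u v a b z y]
      by (intro span_add span_scale base[OF 1] base[OF 2] span_base insertI1)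
  qed
  then have "prd (lcs (n - 3)) (perp (flag k)) \<subseteq> span (insert (mult z y) (lcs (n - 1)))"
    by (rule prd_least[OF subspace_span])
  then have "mid k \<subseteq> span (insert (mult z y) (lcs (n - 1)))"
    unfolding mid_def using base by (intro span_minimal[OF Un_least subspace_span]) blast+
  then have "dim (mid k) \<le> dim (insert (mult z y) (lcs (n - 1)))" by (rule dim_mono)
  then have "dim (mid k) \<le> dim (lcs (n - 1)) + 1" by (simp add: dim_insert split: if_splits)
  moreover have lower: "lcs (n - 1) \<subseteq> mid k" unfolding mid_def using span_superset by blast
  moreover have "dim (lcs (n - 1)) < dim (mid k)"
    using lower k(2) subspace_dim_equal[OF subspace_lcs, of "mid k" "n - 1"]
    by (metis mid_def not_le subspace_span subset_refl)
  moreover have "mid k \<subseteq> lcs (n - 2)"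
    unfolding mid_def
  proof (intro span_minimal Un_least subspace_lcs prd_least)
    show "lcs (n - 1) \<subseteq> lcs (n - 2)" by (rule lcs_antimono) simp
    show "mult u v \<in> lcs (n - 2)" if "u \<in> lcs (n - 3)" for u v
      using mult_in_lcs[OF that] Suc_n by metis
  qed
  ultimately show ?thesis using n_ge_5 dim_lcs_half by (intro exI[of _ k]) simp
qed

section \<open>Assembly of the chain\<close>

lemma characteristic_flag_exists:
  "\<exists>I. I 0 = {0} \<and>
    (\<forall>k<n. I k \<subset> I (Suc k)) \<and>
    I n \<subset> perp (I (n - 1)) \<and>
    (\<forall>k. Suc k < n \<longrightarrow> perp (I (Suc k)) \<subset> perp (I k)) \<and>
    perp (I 0) = UNIV \<and>
    (\<forall>k\<le>n. saa_characteristic_ideal scale form mult (I k)) \<and>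
    (\<forall>k<n. saa_characteristic_ideal scale form mult (perp (I k))) \<and>
    (\<forall>k\<le>n. saa_isotropic form (I k) \<and> dim (I k) = k)"
proof -
  obtain j where j: "lcs (n - 1) \<subseteq> mid j" "mid j \<subseteq> lcs (n - 2)" "dim (mid j) = n"
    using ex_mid by blast
  \<comment> \<open>\<open>flag n\<close> is \<open>lcs (n - 2)\<close>, of dimension
    \<open>n + 1\<close>: the middle loss skips dimension \<open>n\<close>, and \<open>mid j\<close>
    fills the gap.\<close>
  define I where "I k = (if k < n then flag k else mid j)" for k
  have In: "I n = mid j" by (simp add: I_def)
  have Ik: "I k = flag k" if "k < n" for k using that by (simp add: I_def)
  have last: "flag (n - 1) = lcs (n - 1)"
  proof -
    have "2 * n - 2 - (n - 1) = n - 1" "n - 1 \<noteq> 0" "n - 1 \<noteq> 1" using n_ge_5 by auto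
    then show ?thesis by (simp only: flag_def if_False)
  qed

  have sub_mid: "subspace (mid j)" by (simp add: mid_def)
  \<comment> \<open>\<open>lcs (n - 1)\<close> has codimension one in \<open>mid j\<close> and is
    orthogonal to \<open>lcs (n - 2)\<close>, which contains \<open>mid j\<close>.\<close>
  have orth_mid: "orth (mid j) (mid j)"
  proof (rule orth_codim_1[OF subspace_lcs sub_mid j(1)])
    show "dim (mid j) \<le> dim (lcs (n - 1)) + 1" using dim_lcs_half n_ge_5 j(3) by simp
    have "orth (lcs (n - 1)) (lcs (n - 2))" using n_ge_5 by (simp add: orth_lcs)
    then show "orth (lcs (n - 1)) (mid j)" using j(2) by (auto simp: orth_def)
  qed
  have char: "saa_characteristic_ideal scale form mult A"
    if "saa_ideal scale mult A" "invariant A" for A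
    using that by (simp add: saa_characteristic_ideal_def invariant_def)
  have "I k \<subset> I (Suc k)" if "k < n" for k
  proof (cases "Suc k < n")
    case True
    then show ?thesis using flag_psubset by (simp add: Ik)
  next
    case False
    then have k: "Suc k = n" "k = n - 1" using that by auto
    have "lcs (n - 1) \<noteq> mid j" using dim_lcs_half n_ge_5 j(3) by auto
    then show ?thesis using j(1) last k that by (simp add: I_def psubset_eq)
  qed
  moreover have "I n \<subset> perp (I (n - 1))"
  proof -
    have "perp (I (n - 1)) = lcs (n - 2)"
      using perp_flag[of "n - 1"] n_ge_5 by (simp add: Ik numeral_2_eq_2)
    moreover have "dim (lcs (n - 2)) = n + 1" using dim_lcs[of "n - 2"] n_ge_5 by simp
    ultimately show ?thesis using j(2,3) by (auto simp: In)
  qed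
  moreover have "perp (I (Suc k)) \<subset> perp (I k)" if "Suc k < n" for k
  proof -
    have "perp (flag (Suc k)) \<subseteq> perp (flag k)" by (rule perp_antimono[OF flag_mono])
    moreover have "dim (perp (flag (Suc k))) \<noteq> dim (perp (flag k))"
      using that dim_perp_flag by simp
    ultimately show ?thesis using that by (auto simp: Ik)
  qed
  moreover have "saa_characteristic_ideal scale form mult (I k)" if "k \<le> n" for k
  proof (cases "k < n")
    case True
    then show ?thesis by (simp add: Ik char flag_ideal invariant_flag)
  next
    case False
    have "Suc (n - 2) = n - 1" using n_ge_5 by simp
    then have "saa_ideal scale mult (mid j)"
      using saa_ideal_between[OF sub_mid, of "n - 2"] j by metis
    moreover have "invariant (mid j)"
      by (simp add: mid_def invariant_span_Un invariant_lcs invariant_prd invariant_perp invariant_flag)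
    ultimately show ?thesis using False by (simp add: I_def char)
  qed
  moreover have "saa_characteristic_ideal scale form mult (perp (I k))" if "k < n" for k
    using that by (simp add: Ik char perp_ideal flag_ideal invariant_perp invariant_flag)
  moreover have "saa_isotropic form (I k) \<and> dim (I k) = k" if "k \<le> n" for k
  proof (cases "k < n")
    case True
    then show ?thesis using orth_flag[OF True] by (simp add: Ik dim_flag saa_isotropic_def orth_def)
  next
    case False
    then show ?thesis using that orth_mid j(3) by (simp add: I_def saa_isotropic_def orth_def)
  qed
  moreover have "I 0 = {0}" using n_ge_5 by (simp add: I_def flag_def)
  moreover from this have "perp (I 0) = UNIV" by (simp add: saa_perp_def)
  ultimately show ?thesis by (intro exI[of _ I]) blast
qed

end

theorem theorem3p2:
  fixes scale :: "'a::field \<Rightarrow> 'v::ab_group_add \<Rightarrow> 'v"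
    and form :: "'v \<Rightarrow> 'v \<Rightarrow> 'a"
    and mult :: "'v \<Rightarrow> 'v \<Rightarrow> 'v"
    and n :: nat
  assumes "symplectic_alternating_algebra scale form mult"
    and "vector_space.dim scale (UNIV :: 'v set) = 2 * n"
    and "2 * n \<ge> 10"
    and "saa_nilpotent scale mult"
    and "saa_maximal_class scale mult"
  shows "\<exists>I :: nat \<Rightarrow> 'v set.
    I 0 = {0} \<and>
    (\<forall>k<n. I k \<subset> I (Suc k)) \<and>
    I n \<subset> saa_perp form (I (n - 1)) \<and>
    (\<forall>k. Suc k < n \<longrightarrow> saa_perp form (I (Suc k)) \<subset> saa_perp form (I k)) \<and>
    saa_perp form (I 0) = UNIV \<and>
    (\<forall>k\<le>n. saa_characteristic_ideal scale form mult (I k)) \<and>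
    (\<forall>k<n. saa_characteristic_ideal scale form mult (saa_perp form (I k))) \<and>
    (\<forall>k\<le>n. saa_isotropic form (I k) \<and> vector_space.dim scale (I k) = k)"
proof -
  interpret symplectic_alternating_algebra scale form mult by fact
  have "\<exists>m. lcs m = {0}"
    using assms(4) by (simp add: saa_nilpotent_def ex_nilpotent_chain_iff)
  \<comment> \<open>Maximal class carries its own half-dimension, identified with \<open>n\<close>
    through the dimension of the space.\<close>
  moreover have "(LEAST m. lcs m = {0}) = 2 * n - 3"
    using assms(2,5) by (auto simp: saa_maximal_class_def saa_class_def ex_nilpotent_chain_iff)
  ultimately have "lcs (2 * n - 3) = {0}" "\<And>m. m < 2 * n - 3 \<Longrightarrow> lcs m \<noteq> {0}"
    using LeastI_ex[of "\<lambda>m. lcs m = {0}"] not_less_Least[of _ "\<lambda>m. lcs m = {0}"] by auto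
  then interpret maximal_class_saa scale form mult n
    using assms(2,3) by unfold_locales auto
  show ?thesis by (rule characteristic_flag_exists)
qed

end
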